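(* Let $\mathfrak{h}$ be a 6-dimensional real Lie algebra with basis $\{e_1,\dots,e_6\}$, let $D$ be a derivation of $\mathfrak{h}$ whose matrix with respect to $\{e_1,\dots,e_6\}$ is the real representation $\rho(A)$ of some $A\in\mathfrak{sl}(3,\mathbb{C})$, and let $\mathfrak{g}=\mathfrak{h}\oplus_D\mathbb{R}e_7$. Suppose that the $\mathrm{G}_2$ form $$\varphi=e^{127}+e^{347}+e^{567}+e^{135}-e^{146}-e^{236}-e^{245}$$ on $\mathfrak{g}$ (written in the basis $\{e^1,\dots,e^7\}$ dual to $\{e_1,\dots,e_7\}$) is closed. Then $\mathfrak{h}$ has a symplectic half-flat $\mathrm{SU}(3)$-structure.
   Context: Notation: for a basis $\{e_i\}$ of a Lie algebra with dual basis $\{e^i\}$, $e^{ij}=e^i\wedge e^j$, $e^{ijk}=e^i\wedge e^j\wedge e^k$, etc. $d$ is the Chevalley–Eilenberg differential, with $d\alpha(X,Y)=-\alpha([X,Y])$ on 1-forms. A form $\varphi$ is closed if $d\varphi=0$. An $\mathrm{SU}(3)$-structure on a 6-dimensional real Lie algebra $\mathfrak{h}$ is given by a pair $(\omega,\psi_+)\in\Lambda^2\mathfrak{h}^*\times\Lambda^3\mathfrak{h}^*$ for which there is a basis $\{f^1,\dots,f^6\}$ of $\mathfrak{h}^*$ with $\omega=f^{12}+f^{34}+f^{56}$ and $\psi_+=f^{135}-f^{146}-f^{236}-f^{245}$. It is symplectic half-flat if $d\omega=0$ and $d\psi_+=0$. Real representation: $\rho:\mathfrak{gl}(3,\mathbb{C})\to\mathfrak{gl}(6,\mathbb{R})$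 sends $A=(A_{ij})$ to the block matrix $(B_{ij})_{i,j=1}^3$ with $2\times2$ blocks $B_{ij}=\begin{pmatrix}\mathrm{Re}A_{ij}&\mathrm{Im}A_{ij}\\-\mathrm{Im}A_{ij}&\mathrm{Re}A_{ij}\end{pmatrix}$. $\mathfrak{sl}(3,\mathbb{C})$ denotes the trace-free complex $3\times3$ matrices. For a derivation $D$ of $\mathfrak{h}$, $\mathfrak{h}\oplus_D\mathbb{R}e_7$ is the vector space $\mathfrak{h}\oplus\mathbb{R}e_7$ with bracket extending that of $\mathfrak{h}$ and $[e_7,U]=D(U)$ for $U\in\mathfrak{h}$. *)

theory Defs
  imports "HOL-Analysis.Analysis"
begin

section \<open>Bases, Lie algebras, derivations\<close>

text \<open>
  A real Lie algebra is a type of class \<open>real_vector\<close> together with a bracket.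
  Families such as \<open>e\<^sub>1, \<dots>, e\<^sub>n\<close> are functions on \<open>nat\<close> of which only
  the values at \<open>1, \<dots>, n\<close> matter.
\<close>

definition basis_family :: "nat \<Rightarrow> (nat \<Rightarrow> 'v::real_vector) \<Rightarrow> bool" where
  "basis_family n e \<longleftrightarrow>
     inj_on e {1..n} \<and> independent (e ` {1..n}) \<and> span (e ` {1..n}) = UNIV"

definition dual_family :: "nat \<Rightarrow> (nat \<Rightarrow> 'v::real_vector) \<Rightarrow> nat \<Rightarrow> 'v \<Rightarrow> real" where
  "dual_family n e i v = representation (e ` {1..n}) v (e i)"

text \<open>
  A basis \<open>f\<^sup>1, \<dots>, f\<^sup>n\<close> of the dual space. This is spelled out (linearity, independence,
  spanning) because the function type \<open>'v \<Rightarrow> real\<close> is not an instance of \<open>real_vector\<close>.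
\<close>

definition dual_space_basis :: "nat \<Rightarrow> (nat \<Rightarrow> 'v::real_vector \<Rightarrow> real) \<Rightarrow> bool" where
  "dual_space_basis n f \<longleftrightarrow>
     (\<forall>i\<in>{1..n}. linear (f i)) \<and>
     (\<forall>c :: nat \<Rightarrow> real. (\<forall>x. (\<Sum>i=1..n. c i * f i x) = 0) \<longrightarrow> (\<forall>i\<in>{1..n}. c i = 0)) \<and>
     (\<forall>\<alpha>. linear \<alpha> \<longrightarrow> (\<exists>c :: nat \<Rightarrow> real. \<forall>x. \<alpha> x = (\<Sum>i=1..n. c i * f i x)))"

definition lie_bracket :: "('v::real_vector \<Rightarrow> 'v \<Rightarrow> 'v) \<Rightarrow> bool" where
  "lie_bracket br \<longleftrightarrow>
     bilinear br \<and> (\<forall>x. br x x = 0) \<and>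
     (\<forall>x y z. br x (br y z) + br y (br z x) + br z (br x y) = 0)"

definition derivation :: "('v::real_vector \<Rightarrow> 'v \<Rightarrow> 'v) \<Rightarrow> ('v \<Rightarrow> 'v) \<Rightarrow> bool" where
  "derivation br D \<longleftrightarrow>
     linear D \<and> (\<forall>x y. D (br x y) = br (D x) y + br x (D y))"

text \<open>
  The bracket of \<open>\<hh> \<oplus>\<^sub>D \<real>e\<^sub>7\<close> on the vector space \<open>\<hh> \<times> \<real>\<close>, where \<open>U + s e\<^sub>7\<close> is the pair
  \<open>(U, s)\<close>: the bilinear alternating extension of the bracket of \<open>\<hh>\<close> by
  \<open>[e\<^sub>7, U] = D U\<close>.
\<close>

definition semidirect_bracket ::
  "('v::real_vector \<Rightarrow> 'v \<Rightarrow> 'v) \<Rightarrow> ('v \<Rightarrow> 'v) \<Rightarrow> 'v \<times> real \<Rightarrow> 'v \<times> real \<Rightarrow> 'v \<times> real" where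
  "semidirect_bracket br D X Y =
     (br (fst X) (fst Y) + snd X *\<^sub>R D (fst Y) - snd Y *\<^sub>R D (fst X), 0)"

definition extend_family :: "(nat \<Rightarrow> 'v::real_vector) \<Rightarrow> nat \<Rightarrow> 'v \<times> real" where
  "extend_family e i = (if i = 7 then (0, 1) else (e i, 0))"


section \<open>The real representation of complex matrices\<close>

definition sl3_complex :: "(complex ^ 3 ^ 3) set" where
  "sl3_complex = {A. trace A = 0}"

text \<open>
  The entry in row \<open>p\<close> and column \<open>q\<close> (\<open>p, q \<in> {1..6}\<close>) of the real matrix whose
  \<open>2 \<times> 2\<close> block in position \<open>(i, j)\<close> has rows \<open>(Re A\<^sub>i\<^sub>j, Im A\<^sub>i\<^sub>j)\<close> and
  \<open>(-Im A\<^sub>i\<^sub>j, Re A\<^sub>i\<^sub>j)\<close>; row \<open>p\<close> lies in block row \<open>(p + 1) div 2\<close>, and it is the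
  upper row of the block iff \<open>p\<close> is odd. The three elements of the index type \<open>3\<close> are
  \<open>1\<close>, \<open>2\<close> and \<open>3 = 0\<close>.
\<close>

definition real_rep :: "complex ^ 3 ^ 3 \<Rightarrow> nat \<Rightarrow> nat \<Rightarrow> real" where
  "real_rep A p q =
     (let a = A $ of_nat ((p + 1) div 2) $ of_nat ((q + 1) div 2) in
      if odd p then (if odd q then Re a else Im a)
      else (if odd q then - Im a else Re a))"

definition has_matrix ::
  "nat \<Rightarrow> (nat \<Rightarrow> 'v::real_vector) \<Rightarrow> ('v \<Rightarrow> 'v) \<Rightarrow> (nat \<Rightarrow> nat \<Rightarrow> real) \<Rightarrow> bool" where
  "has_matrix n e D M \<longleftrightarrow> (\<forall>j\<in>{1..n}. D (e j) = (\<Sum>i=1..n. M i j *\<^sub>R e i))"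


section \<open>Exterior forms\<close>

text \<open>
  A \<open>k\<close>-form is a real function of argument lists, extended by \<open>0\<close> to lists whose length is
  not \<open>k\<close>; thus two \<open>k\<close>-forms are equal as functions iff they agree on all \<open>k\<close>-tuples.
\<close>

definition alt_forms :: "nat \<Rightarrow> ('v::real_vector list \<Rightarrow> real) set" where
  "alt_forms k = {\<alpha>.
     (\<forall>vs. length vs \<noteq> k \<longrightarrow> \<alpha> vs = 0) \<and>
     (\<forall>vs. length vs = k \<longrightarrow> (\<forall>i<k. linear (\<lambda>x. \<alpha> (vs[i := x])))) \<and>
     (\<forall>vs. length vs = k \<longrightarrow> (\<forall>i<k. \<forall>j<k. i \<noteq> j \<and> vs ! i = vs ! j \<longrightarrow> \<alpha> vs = 0))}"

text \<open>
  The wedge product of 1-forms,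
  \<open>(\<alpha>\<^sub>1 \<and> \<dots> \<and> \<alpha>\<^sub>k) (v\<^sub>1, \<dots>, v\<^sub>k) = det (\<alpha>\<^sub>a (v\<^sub>b))\<close>, so that \<open>e\<^sup>1\<^sup>2 (e\<^sub>1, e\<^sub>2) = 1\<close>.
\<close>

definition wedge :: "('v \<Rightarrow> real) list \<Rightarrow> 'v list \<Rightarrow> real" where
  "wedge as vs =
     (if length vs = length as
      then \<Sum>p | p permutes {..<length as}.
             of_int (sign p) * (\<Prod>i<length as. (as ! i) (vs ! p i))
      else 0)"

text \<open>For example, \<open>wedge_ix f [1, 3, 5]\<close> is \<open>f\<^sup>1\<^sup>3\<^sup>5\<close>.\<close>

definition wedge_ix :: "(nat \<Rightarrow> 'v \<Rightarrow> real) \<Rightarrow> nat list \<Rightarrow> 'v list \<Rightarrow> real" where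
  "wedge_ix f is = wedge (map f is)"

text \<open>
  The Chevalley--Eilenberg differential (with trivial coefficients)
  \<open>d\<alpha> (X\<^sub>0, \<dots>, X\<^sub>k) = \<Sum>\<^sub>i\<^sub><\<^sub>j (-1)\<^sup>i\<^sup>+\<^sup>j \<alpha> ([X\<^sub>i, X\<^sub>j], X\<^sub>0, \<dots>, X\<^sub>k without X\<^sub>i, X\<^sub>j)\<close>.
  On 1-forms this is \<open>d\<alpha> (X, Y) = - \<alpha> [X, Y]\<close>.
\<close>

definition ce_diff ::
  "('v \<Rightarrow> 'v \<Rightarrow> 'v) \<Rightarrow> ('v list \<Rightarrow> real) \<Rightarrow> 'v list \<Rightarrow> real" where
  "ce_diff br \<alpha> vs =
     (\<Sum>j<length vs. \<Sum>i<j. (- 1) ^ (i + j) * \<alpha> (br (vs ! i) (vs ! j) # nths vs (- {i, j})))"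

definition ce_closed :: "('v \<Rightarrow> 'v \<Rightarrow> 'v) \<Rightarrow> ('v list \<Rightarrow> real) \<Rightarrow> bool" where
  "ce_closed br \<alpha> \<longleftrightarrow> (\<forall>vs. ce_diff br \<alpha> vs = 0)"


section \<open>The model forms and symplectic half-flat structures\<close>

definition su3_omega :: "(nat \<Rightarrow> 'v \<Rightarrow> real) \<Rightarrow> 'v list \<Rightarrow> real" where
  "su3_omega f vs = wedge_ix f [1,2] vs + wedge_ix f [3,4] vs + wedge_ix f [5,6] vs"

definition su3_psi :: "(nat \<Rightarrow> 'v \<Rightarrow> real) \<Rightarrow> 'v list \<Rightarrow> real" where
  "su3_psi f vs =
     wedge_ix f [1,3,5] vs - wedge_ix f [1,4,6] vs - wedge_ix f [2,3,6] vs - wedge_ix f [2,4,5] vs"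

definition g2_form :: "(nat \<Rightarrow> 'v \<Rightarrow> real) \<Rightarrow> 'v list \<Rightarrow> real" where
  "g2_form f vs =
     wedge_ix f [1,2,7] vs + wedge_ix f [3,4,7] vs + wedge_ix f [5,6,7] vs
     + wedge_ix f [1,3,5] vs - wedge_ix f [1,4,6] vs - wedge_ix f [2,3,6] vs - wedge_ix f [2,4,5] vs"

definition su3_structure ::
  "('v::real_vector list \<Rightarrow> real) \<Rightarrow> ('v list \<Rightarrow> real) \<Rightarrow> bool" where
  "su3_structure \<omega> \<psi> \<longleftrightarrow>
     \<omega> \<in> alt_forms 2 \<and> \<psi> \<in> alt_forms 3 \<and>
     (\<exists>f. dual_space_basis 6 f \<and> \<omega> = su3_omega f \<and> \<psi> = su3_psi f)"

definition symplectic_half_flat ::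
  "('v::real_vector \<Rightarrow> 'v \<Rightarrow> 'v) \<Rightarrow> ('v list \<Rightarrow> real) \<Rightarrow> ('v list \<Rightarrow> real) \<Rightarrow> bool" where
  "symplectic_half_flat br \<omega> \<psi> \<longleftrightarrow> su3_structure \<omega> \<psi> \<and> ce_closed br \<omega> \<and> ce_closed br \<psi>"

end

theory Submission
  imports Defs
begin

text \<open>
  Write \<open>\<phi> = \<omega> \<and> e\<^sup>7 + \<psi>\<close> with \<open>\<omega>\<close> and \<open>\<psi>\<close> the model forms in the dual basis of \<open>\<hh>\<close>; these
  two forms are the required structure. Evaluating \<open>d\<phi> = 0\<close> on four vectors of \<open>\<hh>\<close> gives \<open>d\<psi> = 0\<close>.
  Evaluating it on \<open>X, Y, Z \<in> \<hh>\<close> and \<open>e\<^sub>7\<close> gives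
  \<open>d\<omega> (X, Y, Z) = - (\<psi> (D X, Y, Z) + \<psi> (X, D Y, Z) + \<psi> (X, Y, D Z))\<close>. Since \<open>\<psi>\<close> is the real part
  of the complex volume form, and \<open>D\<close> is complex linear with matrix the conjugate of \<open>A\<close>, the right-hand
  side is minus the real part of the conjugate of \<open>trace A\<close> times the volume form, hence zero.
\<close>

section \<open>Coordinates with respect to a basis, and the dual basis\<close>

lemma dual_family_sum:
  assumes "basis_family n e" "j \<in> {1..n}"
  shows "dual_family n e j (\<Sum>i=1..n. c i *\<^sub>R e i) = c j"
proof -
  have inj: "inj_on e {1..n}" and ind: "independent (e ` {1..n})"
    using assms by (auto simp: basis_family_def)
  have sp: "e i \<in> span (e ` {1..n})" if "i \<in> {1..n}" for i
    using that by (intro span_base imageI)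
  have "representation (e ` {1..n}) (\<Sum>i=1..n. c i *\<^sub>R e i) (e j)
      = (\<Sum>i=1..n. c i * representation (e ` {1..n}) (e i) (e j))"
    by (subst representation_sum[OF ind], rule span_scale, erule sp)
       (intro sum.cong refl, simp only: representation_scale[OF ind sp])
  also have "\<dots> = (\<Sum>i=1..n. if i = j then c i else 0)"
  proof (rule sum.cong)
    fix i assume "i \<in> {1..n}"
    then show "c i * representation (e ` {1..n}) (e i) (e j) = (if i = j then c i else 0)"
      using inj_on_eq_iff[OF inj] assms(2)
      by (subst representation_basis[OF ind imageI]) auto
  qed simp
  also have "\<dots> = c j" using assms(2) by simp
  finally show ?thesis by (simp add: dual_family_def)
qed

lemma dual_family_expansion:
  assumes "basis_family n e"
  shows "(\<Sum>i=1..n. dual_family n e i v *\<^sub>R e i) = v"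
proof -
  have inj: "inj_on e {1..n}" and ind: "independent (e ` {1..n})"
    and sp: "span (e ` {1..n}) = UNIV"
    using assms by (auto simp: basis_family_def)
  have "(\<Sum>b\<in>e ` {1..n}. representation (e ` {1..n}) v b *\<^sub>R b) = v"
    by (rule sum_representation_eq[OF ind])
       (simp_all only: sp UNIV_I finite_imageI finite_atLeastAtMost subset_UNIV order_refl)
  then show ?thesis
    by (simp only: sum.reindex[OF inj] dual_family_def comp_def)
qed

lemma linear_dual_family:
  assumes "basis_family n e"
  shows "linear (dual_family n e i)"
  using assms unfolding dual_family_def basis_family_def
  by (intro linearI) (simp_all add: representation_add representation_scale)

lemma dual_space_basis_dual_family:
  assumes "basis_family n e"
  shows "dual_space_basis n (dual_family n e)"
  unfolding dual_space_basis_def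
proof (intro conjI ballI allI impI)
  fix i show "linear (dual_family n e i)" by (rule linear_dual_family[OF assms])
next
  fix c :: "nat \<Rightarrow> real" and j
  assume c: "\<forall>x. (\<Sum>i=1..n. c i * dual_family n e i x) = 0" and j: "j \<in> {1..n}"
  \<comment> \<open>Evaluating the vanishing functional at the vector whose coordinates are the
    coefficients \<open>c\<close> themselves gives a sum of squares.\<close>
  have "(\<Sum>i=1..n. c i * dual_family n e i (\<Sum>k=1..n. c k *\<^sub>R e k)) = (\<Sum>i=1..n. c i * c i)"
    by (rule sum.cong[OF refl], subst dual_family_sum[OF assms]) auto
  then have "(\<Sum>i=1..n. c i * c i) = 0" using c by simp
  then show "c j = 0" using j by (simp add: sum_nonneg_eq_0_iff)
next
  fix \<alpha> :: "'a \<Rightarrow> real" assume \<alpha>: "linear \<alpha>"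
  have "\<forall>x. \<alpha> x = (\<Sum>i=1..n. \<alpha> (e i) * dual_family n e i x)"
  proof
    fix x show "\<alpha> x = (\<Sum>i=1..n. \<alpha> (e i) * dual_family n e i x)"
    by (subst (1) dual_family_expansion[OF assms, of x, symmetric])
       (simp add: linear_sum[OF \<alpha>] linear_scale[OF \<alpha>] mult.commute)
  qed
  then show "\<exists>c. \<forall>x. \<alpha> x = (\<Sum>i=1..n. c i * dual_family n e i x)"
    by (intro exI[where x="\<lambda>i. \<alpha> (e i)"])
qed

text \<open>The columns of \<open>M\<close> hold the images of basis vectors, so on coordinate
  vectors \<open>D\<close> acts by the rows of \<open>M\<close>. In this form
  \<open>real_rep A\<close> can be read as a complex matrix acting on complex coordinates.\<close>

lemma dual_family_has_matrix:
  assumes e: "basis_family n e" and D: "linear D" "has_matrix n e D M" and i: "i \<in> {1..n}"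
  shows "dual_family n e i (D x) = (\<Sum>j=1..n. M i j * dual_family n e j x)"
proof -
  have "D x = (\<Sum>j=1..n. dual_family n e j x *\<^sub>R D (e j))"
    by (subst (1) dual_family_expansion[OF e, of x, symmetric])
       (simp add: linear_sum[OF D(1)] linear_scale[OF D(1)])
  then have "dual_family n e i (D x) = (\<Sum>j=1..n. dual_family n e j x * dual_family n e i (D (e j)))"
    by (simp add: linear_sum[OF linear_dual_family[OF e]] linear_scale[OF linear_dual_family[OF e]])
  also have "\<dots> = (\<Sum>j=1..n. M i j * dual_family n e j x)"
  proof (rule sum.cong[OF refl])
    fix j assume "j \<in> {1..n}"
    then have "D (e j) = (\<Sum>i=1..n. M i j *\<^sub>R e i)" using D(2) by (simp add: has_matrix_def)
    then show "dual_family n e j x * dual_family n e i (D (e j)) = M i j * dual_family n e j x"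
      by (simp only: dual_family_sum[OF e i] mult.commute)
  qed
  finally show ?thesis .
qed

section \<open>The extended basis of the semidirect sum and its dual\<close>

lemma extend_family_image:
  "extend_family e ` {1..7} = insert (0, 1) ((\<lambda>x. (x, 0)) ` e ` {1..6})"
proof -
  have "{1..7::nat} = insert 7 {1..6}" by auto
  then have "extend_family e ` {1..7} = insert (0, 1) (extend_family e ` {1..6})"
    by (simp only: image_insert) (simp add: extend_family_def)
  also have "extend_family e ` {1..6} = (\<lambda>x. (x, 0)) ` e ` {1..6}"
    by (auto simp: extend_family_def image_iff)
  finally show ?thesis .
qed

lemma basis_family_extend_family:
  assumes "basis_family 6 e"
  shows "basis_family 7 (extend_family e)"
proof -
  let ?j = "\<lambda>x::'a. (x, 0::real)" and ?B = "e ` {1..6}"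
  have inj: "inj_on e {1..6}" and ind: "independent ?B" and sp: "span ?B = UNIV"
    using assms by (auto simp: basis_family_def)
  have lin: "linear ?j" by (rule linearI) auto
  have spj: "span (?j ` ?B) = range ?j"
    using linear_span_image[OF lin, of ?B] sp by simp
  have "independent (?j ` ?B)"
    by (rule linear_independent_injective_image[OF lin ind]) (auto simp: inj_on_def)
  moreover have "(0, 1) \<notin> span (?j ` ?B)" using spj by auto
  ultimately have "independent (extend_family e ` {1..7})"
    unfolding extend_family_image by (rule independent_insertI[rotated])
  moreover have "v \<in> span (extend_family e ` {1..7})" for v
  proof -
    obtain x s where v: "v = (x, s)" by (cases v)
    \<comment> \<open>Subtracting the e_7-component leaves a vector of the embedded copy of
      h.\<close>
    have "v - s *\<^sub>R (0, 1) \<in> span (?j ` ?B)" unfolding spj v by simp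
    then show ?thesis unfolding extend_family_image span_insert by blast
  qed
  moreover have "inj_on (extend_family e) {1..7}"
  proof (rule inj_onI)
    fix i j :: nat assume "i \<in> {1..7}" "j \<in> {1..7}" "extend_family e i = extend_family e j"
    then show "i = j"
      using inj by (auto simp: extend_family_def inj_on_eq_iff split: if_splits)
  qed
  ultimately show ?thesis by (auto simp: basis_family_def)
qed

text \<open>Coordinates are unique, so it suffices to exhibit \<open>(x, s)\<close> as the
  combination of the extended basis with these coefficients.\<close>

lemma dual_family_extend_family:
  assumes "basis_family 6 e" "i \<in> {1..7}"
  shows "dual_family 7 (extend_family e) i (x, s) = (if i = 7 then s else dual_family 6 e i x)"
proof -
  have split: "{1..7::nat} = insert 7 {1..6}" by auto
  have "(\<Sum>i=1..7. (if i = 7 then s else dual_family 6 e i x) *\<^sub>R extend_family e i)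
      = s *\<^sub>R (0, 1) + (\<Sum>i=1..6. (dual_family 6 e i x *\<^sub>R e i, 0))"
    unfolding split by (simp add: extend_family_def)
  also have "(\<Sum>i=1..6. (dual_family 6 e i x *\<^sub>R e i, 0::real)) = (x, 0)"
    using dual_family_expansion[OF assms(1), of x] by (simp add: prod_eq_iff fst_sum snd_sum)
  finally have "(x, s) = (\<Sum>i=1..7. (if i = 7 then s else dual_family 6 e i x) *\<^sub>R extend_family e i)"
    by simp
  then show ?thesis
    using dual_family_sum[OF basis_family_extend_family[OF assms(1)] assms(2)] by simp
qed

section \<open>Explicit wedge products and the model SU(3)-structure\<close>

lemma wedge_2: "wedge [a, b] [x, y] = a x * b y - a y * b x"
proof -
  have s: "{..<2} = {0, 1::nat}" by auto
  show ?thesis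
    unfolding wedge_def
    by (simp add: numeral_2_eq_2[symmetric] s sum_over_permutations_insert sign_swap_id
        permutes_empty transpose_def)
qed

lemma wedge_3:
  "wedge [a, b, c] [x, y, z] =
     a x * (b y * c z - b z * c y) - a y * (b x * c z - b z * c x) + a z * (b x * c y - b y * c x)"
proof -
  have s: "{..<3} = {0, 1, 2::nat}" by auto
  show ?thesis
    unfolding wedge_def
    by (simp add: numeral_3_eq_3[symmetric] s sum_over_permutations_insert sign_swap_id sign_compose
        permutation_swap_id swap_id_common transpose_def algebra_simps)
qed

lemma wedge_eq_0: "length vs \<noteq> length as \<Longrightarrow> wedge as vs = 0"
  by (simp add: wedge_def)

lemma alt_forms_add:
  assumes "\<alpha> \<in> alt_forms k" "\<beta> \<in> alt_forms k"
  shows "(\<lambda>vs. \<alpha> vs + \<beta> vs) \<in> alt_forms k"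
  using assms unfolding alt_forms_def
  by (auto intro!: linear_compose_add)

lemma alt_forms_diff:
  assumes "\<alpha> \<in> alt_forms k" "\<beta> \<in> alt_forms k"
  shows "(\<lambda>vs. \<alpha> vs - \<beta> vs) \<in> alt_forms k"
  using assms unfolding alt_forms_def
  by (auto intro!: linear_compose_sub)

lemma wedge_2_alt:
  assumes "linear a" "linear b"
  shows "wedge [a, b] \<in> alt_forms 2"
proof -
  note lin = assms[THEN linear_add] assms[THEN linear_scale]
  have "linear (\<lambda>x. wedge [a, b] ([v, w][i := x]))" if "i < 2" for v w i
    using less_2_cases[OF that]
    by (auto simp: wedge_2 lin algebra_simps intro!: linearI)
  moreover have "wedge [a, b] [v, w] = 0"
    if "i < 2" "j < 2" "i \<noteq> j" "[v, w] ! i = [v, w] ! j" for v w i j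
    using less_2_cases[OF that(1)] less_2_cases[OF that(2)] that(3,4) by (auto simp: wedge_2)
  ultimately show ?thesis
    by (auto simp: alt_forms_def wedge_eq_0 numeral_2_eq_2 length_Suc_conv)
qed

lemma wedge_3_alt:
  assumes "linear a" "linear b" "linear c"
  shows "wedge [a, b, c] \<in> alt_forms 3"
proof -
  note lin = assms[THEN linear_add] assms[THEN linear_scale]
  have cases: "i = 0 \<or> i = 1 \<or> i = 2" if "i < 3" for i :: nat using that by auto
  have "linear (\<lambda>x. wedge [a, b, c] ([u, v, w][i := x]))" if "i < 3" for u v w i
    using cases[OF that]
    by (auto simp: wedge_3 lin algebra_simps intro!: linearI)
  moreover have "wedge [a, b, c] [u, v, w] = 0"
    if "i < 3" "j < 3" "i \<noteq> j" "[u, v, w] ! i = [u, v, w] ! j" for u v w i j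
    using cases[OF that(1)] cases[OF that(2)] that(3,4)
    by (auto simp: wedge_3 algebra_simps)
  ultimately show ?thesis
    by (auto simp: alt_forms_def wedge_eq_0 numeral_3_eq_3 length_Suc_conv)
qed

lemma su3_structure_model:
  assumes "dual_space_basis 6 f"
  shows "su3_structure (su3_omega f) (su3_psi f)"
proof -
  have lin: "linear (f i)" if "i \<in> {1..6}" for i
    using assms that by (simp add: dual_space_basis_def)
  have "su3_omega f \<in> alt_forms 2" "su3_psi f \<in> alt_forms 3"
    unfolding su3_omega_def su3_psi_def wedge_ix_def list.map
    by (intro alt_forms_add alt_forms_diff wedge_2_alt wedge_3_alt lin; simp)+
  then show ?thesis using assms unfolding su3_structure_def by blast
qed

section \<open>The complex volume form and the trace\<close>

lemma sum_1_3: "(\<Sum>i=1..3. g i) = g 1 + g 2 + g (3::nat)"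
  by (simp add: numeral_3_eq_3 numeral_2_eq_2)

lemma sum_1_6: "(\<Sum>i=1..6. g i) = g 1 + g 2 + g 3 + g 4 + g 5 + g (6::nat)"
  by (simp add: eval_nat_numeral)

text \<open>The determinant of the 3 by 3 matrix with columns \<open>u\<close>, \<open>v\<close>,
  \<open>w\<close>, where only the entries at 1, 2, 3 count.\<close>

definition cvol :: "(nat \<Rightarrow> complex) \<Rightarrow> (nat \<Rightarrow> complex) \<Rightarrow> (nat \<Rightarrow> complex) \<Rightarrow> complex" where
  "cvol u v w = u 1 * (v 2 * w 3 - w 2 * v 3) - v 1 * (u 2 * w 3 - w 2 * u 3)
     + w 1 * (u 2 * v 3 - v 2 * u 3)"

text \<open>The infinitesimal form of det(BX) = det(B) det(X): differentiate at t = 0 with B = 1 +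
  tM. Written out in entries it is a polynomial identity.\<close>

lemma cvol_matrix_trace:
  fixes M :: "nat \<Rightarrow> nat \<Rightarrow> complex"
  defines "L \<equiv> \<lambda>u a. \<Sum>b=1..3. M a b * u b"
  shows "cvol (L u) v w + cvol u (L v) w + cvol u v (L w) = (\<Sum>a=1..3. M a a) * cvol u v w"
  unfolding cvol_def L_def sum_1_3 by algebra

definition ccoord :: "(nat \<Rightarrow> 'v \<Rightarrow> real) \<Rightarrow> 'v \<Rightarrow> nat \<Rightarrow> complex" where
  "ccoord f v a = Complex (f (2 * a - 1) v) (f (2 * a) v)"

text \<open>Expand (f^1 + i f^2) \<and> (f^3 + i f^4) \<and> (f^5 + i f^6): the real terms have no
  imaginary factor, or two of them and then the sign of i^2.\<close>

lemma su3_psi_eq_Re_cvol: "su3_psi f [x, y, z] = Re (cvol (ccoord f x) (ccoord f y) (ccoord f z))"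
  unfolding su3_psi_def wedge_ix_def list.map wedge_3 cvol_def ccoord_def
  by simp algebra

lemma su3_psi_derivation:
  assumes A: "A \<in> sl3_complex"
    and D: "\<And>i x. i \<in> {1..6} \<Longrightarrow> f i (D x) = (\<Sum>j=1..6. real_rep A i j * f j x)"
  shows "su3_psi f [D x, y, z] + su3_psi f [x, D y, z] + su3_psi f [x, y, D z] = 0"
proof -
  \<comment> \<open>A block with rows (Re a, Im a) and (-Im a, Re a) sends x + iy to (Re a - i Im
    a)(x + iy), hence the conjugate.\<close>
  define M where "M a b = cnj (A $ of_nat a $ of_nat b)" for a b
  have c: "ccoord f (D v) a = (\<Sum>b=1..3. M a b * ccoord f v b)" if "a \<in> {1, 2, 3}" for v a
    using that unfolding sum_1_3 ccoord_def
    by (auto simp: D[unfolded sum_1_6] M_def real_rep_def complex_eq_iff algebra_simps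
        numeral_2_eq_2[symmetric])
  \<comment> \<open>Fact \<open>c\<close> describes \<open>ccoord f (D v)\<close> only at 1, 2, 3,
    so the rewriting below needs a congruence confined to these indices instead of equality of
    functions.\<close>
  have cvol_cong: "cvol u v w = cvol u' v' w'"
    if "\<forall>a\<in>{1, 2, 3}. u a = u' a \<and> v a = v' a \<and> w a = w' a" for u v w u' v' w'
    using that by (simp add: cvol_def)
  let ?L = "\<lambda>u a. \<Sum>b=1..3. M a b * u b"
  have "(\<Sum>a=1..3. M a a) = cnj (trace A)"
    unfolding sum_1_3 by (simp add: M_def trace_def sum_3)
  also have "\<dots> = 0" using A by (simp add: sl3_complex_def)
  finally have tr: "(\<Sum>a=1..3. M a a) = 0" .
  have "su3_psi f [D x, y, z] + su3_psi f [x, D y, z] + su3_psi f [x, y, D z]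
      = Re (cvol (?L (ccoord f x)) (ccoord f y) (ccoord f z)
          + cvol (ccoord f x) (?L (ccoord f y)) (ccoord f z)
          + cvol (ccoord f x) (ccoord f y) (?L (ccoord f z)))"
    unfolding su3_psi_eq_Re_cvol plus_complex.sel
    by (intro arg_cong2[where f="(+)"] arg_cong[where f=Re] cvol_cong) (simp_all add: c)
  also have "\<dots> = 0" unfolding cvol_matrix_trace tr by simp
  finally show ?thesis .
qed

section \<open>Low-degree differentials and the restriction of the G2 form to h\<close>

lemma ce_diff_2_form:
  "ce_diff br \<alpha> [x, y, z] = - \<alpha> [br x y, z] + \<alpha> [br x z, y] - \<alpha> [br y z, x]"
proof -
  have s: "{..<3} = {0, 1, 2::nat}" "{..<2} = {0, 1::nat}" by auto
  show ?thesis
    unfolding ce_diff_def by (simp add: numeral_3_eq_3[symmetric] s nths_Cons)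
qed

lemma ce_diff_3_form:
  "ce_diff br \<alpha> [x, y, z, w] = - \<alpha> [br x y, z, w] + \<alpha> [br x z, y, w] - \<alpha> [br y z, x, w]
     - \<alpha> [br x w, y, z] + \<alpha> [br y w, x, z] - \<alpha> [br z w, x, y]"
proof -
  have s: "{..<4} = {0, 1, 2, 3::nat}" "{..<3} = {0, 1, 2::nat}" "{..<2} = {0, 1::nat}" by auto
  have 4: "Suc (Suc (Suc (Suc 0))) = 4" by simp
  show ?thesis
    unfolding ce_diff_def by (simp add: 4 s nths_Cons)
qed

text \<open>On h the covector e^7 vanishes, which kills the \<omega>-part; in the last slot e_7 has
  zero h-coordinates, which kills the \<psi>-part.\<close>

lemma g2_form_extend_family:
  assumes e: "basis_family 6 e"
  defines "f \<equiv> dual_family 6 e" and "F \<equiv> dual_family 7 (extend_family e)"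
  shows "g2_form F [(x, 0), (y, 0), (z, 0)] = su3_psi f [x, y, z]"
    and "g2_form F [(x, 0), (y, 0), (0, 1)] = su3_omega f [x, y]"
proof -
  have f0: "f i 0 = 0" for i
    unfolding f_def by (rule linear_0[OF linear_dual_family[OF e]])
  note F = dual_family_extend_family[OF e, folded f_def F_def]
  show "g2_form F [(x, 0), (y, 0), (z, 0)] = su3_psi f [x, y, z]"
    by (simp add: g2_form_def su3_psi_def wedge_ix_def wedge_3 F)
  show "g2_form F [(x, 0), (y, 0), (0, 1)] = su3_omega f [x, y]"
    by (simp add: g2_form_def su3_omega_def wedge_ix_def wedge_3 wedge_2 F f0)
qed

text \<open>Each term of the differential replaces two arguments by one bracket and so evaluates the
  form on a list one shorter than \<open>vs\<close>. This disposes of the lists of wrong length over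
  which \<open>ce_closed\<close> also quantifies.\<close>

lemma ce_diff_eq_0:
  assumes "\<And>vs. length vs \<noteq> k \<Longrightarrow> \<alpha> vs = 0" "length vs \<noteq> Suc k"
  shows "ce_diff br \<alpha> vs = 0"
proof -
  have "Suc (length (nths vs (- {i, j}))) \<noteq> k" if "i < j" "j < length vs" for i j
  proof -
    have "{k. k < length vs \<and> k \<in> - {i, j}} = {..<length vs} - {i, j}" by auto
    then have "length (nths vs (- {i, j})) = length vs - 2"
      using that by (simp add: length_nths card_Diff_subset)
    then show ?thesis using assms(2) that by simp
  qed
  then show ?thesis
    by (auto simp: ce_diff_def assms(1) intro!: sum.neutral)
qed

section \<open>Closedness of the two model forms\<close>

theorem proposition1p4:
  fixes br :: "'h::real_vector \<Rightarrow> 'h \<Rightarrow> 'h"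
    and e :: "nat \<Rightarrow> 'h"
    and D :: "'h \<Rightarrow> 'h"
    and A :: "complex ^ 3 ^ 3"
  assumes "lie_bracket br"
    and "basis_family 6 e"
    and "derivation br D"
    and "A \<in> sl3_complex"
    and "has_matrix 6 e D (real_rep A)"
    and "ce_closed (semidirect_bracket br D) (g2_form (dual_family 7 (extend_family e)))"
  shows "\<exists>\<omega> \<psi>. symplectic_half_flat br \<omega> \<psi>"
proof -
  define f where "f = dual_family 6 e"
  let ?sb = "semidirect_bracket br D"
  let ?\<phi> = "g2_form (dual_family 7 (extend_family e))"
  note e = assms(2)
  note \<phi> = g2_form_extend_family[OF e, folded f_def]
  have linD: "linear D" using assms(3) by (simp add: derivation_def)
  have linf: "linear (f i)" for i unfolding f_def by (rule linear_dual_family[OF e])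
  have d\<phi>: "ce_diff ?sb ?\<phi> vs = 0" for vs using assms(6) by (simp add: ce_closed_def)
  have neg: "su3_psi f [- x, y, z] = - su3_psi f [x, y, z]" for x y z
    by (simp add: su3_psi_def wedge_ix_def wedge_3 linear_neg[OF linf] algebra_simps)
  have swap: "su3_psi f [y, x, z] = - su3_psi f [x, y, z]" "su3_psi f [x, z, y] = - su3_psi f [x, y, z]"
    for x y z unfolding su3_psi_def wedge_ix_def list.map wedge_3 by algebra+
  have lie: "su3_psi f [D x, y, z] + su3_psi f [x, D y, z] + su3_psi f [x, y, D z] = 0" for x y z
    using dual_family_has_matrix[OF e linD assms(5)]
    by (intro su3_psi_derivation[OF assms(4)]) (simp add: f_def)
  \<comment> \<open>With e_7 as second argument the bracket is -D x; \<open>neg\<close> moves this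
    sign out of \<psi>.\<close>
  have br0: "?sb (x, 0) (y, 0) = (br x y, 0)" "?sb (x, 0) (0, 1) = (- D x, 0)" for x y
    using linear_0[OF linD] bilinear_rzero[of br] assms(1)
    by (simp_all add: lie_bracket_def semidirect_bracket_def)
  \<comment> \<open>The three brackets inside h contribute d\<omega>. The three with e_7 put
    \<open>D x\<close>, \<open>D y\<close>, \<open>D z\<close> in the first slot; one transposition
    for \<open>D y\<close> and two for \<open>D z\<close> restore the order, so they add up to
    \<open>lie\<close>.\<close>
  have "ce_diff br (su3_omega f) [x, y, z] = 0" for x y z
    using d\<phi>[of "[(x, 0), (y, 0), (z, 0), (0, 1)]"] lie[of x y z]
      swap(1)[of "D y" x z] swap(1)[of "D z" x y] swap(2)[of x "D z" y]
    unfolding ce_diff_2_form ce_diff_3_form by (simp add: br0 \<phi> neg)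
  moreover have "ce_diff br (su3_omega f) vs = 0" if "length vs \<noteq> 3" for vs
    using that by (intro ce_diff_eq_0[where k=2]) (auto simp: su3_omega_def wedge_ix_def wedge_eq_0)
  ultimately have \<omega>: "ce_closed br (su3_omega f)"
    unfolding ce_closed_def
    by (metis (no_types, opaque_lifting) length_Suc_conv length_0_conv numeral_3_eq_3)
  \<comment> \<open>All arguments and brackets stay in h, where the G2 form restricts to
    \<psi>.\<close>
  have "ce_diff br (su3_psi f) [x, y, z, w] = 0" for x y z w
    using d\<phi>[of "[(x, 0), (y, 0), (z, 0), (w, 0)]"]
    unfolding ce_diff_3_form by (simp add: br0 \<phi>)
  moreover have "ce_diff br (su3_psi f) vs = 0" if "length vs \<noteq> 4" for vs
    using that by (intro ce_diff_eq_0[where k=3]) (auto simp: su3_psi_def wedge_ix_def wedge_eq_0)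
  moreover have "\<exists>x y z w. vs = [x, y, z, w]" if "length vs = 4" for vs :: "'h list"
    using that by (auto simp: eval_nat_numeral length_Suc_conv)
  ultimately have \<psi>: "ce_closed br (su3_psi f)"
    unfolding ce_closed_def by metis
  have "su3_structure (su3_omega f) (su3_psi f)"
    unfolding f_def by (intro su3_structure_model dual_space_basis_dual_family e)
  with \<omega> \<psi> show ?thesis unfolding symplectic_half_flat_def by blast
qed

end
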